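(* For an even $d$ let $\underline{s}^{(d)}=(s^{(d)}_0,s^{(d)}_1,\dots ,s^{(d)}_d)$ be defined by $$s^{(d)}_k=\begin{cases} \dfrac{\binom{d}{d/2}\binom{d/2}{k/2}}{2^{d/2}\binom{d}{k}} & \text{if } k \text{ is even},\\[2mm] 0 & \text{if } k \text{ is odd}.\end{cases}$$ Let $G$ be a graph in which every vertex $v$ has even degree $d_v$, and let $\underline{s}$ be the vector obtained by substituting, for every vertex $v$, the vector $\underline{s}^{(d_v)}$ into the variables $x^{v}_0,\dots ,x^{v}_{d_v}$, i.e. $x^v_k=s^{(d_v)}_k$. Then $F_G(\underline{s})$ is equal to the number of Eulerian orientations of $G$.
   Context: Graphs are finite. For a graph $G$ with degrees $d_v$, introduce $d_v+1$ variables $x^v_0,x^v_1,\dots,x^v_{d_v}$ for each vertex $v$, and let $\underline{x}$ be the collection of all of them. The subgraph counting polynomial is $$F_G(\underline{x})=\sum_{A \subseteq E(G)}\prod_{v\in V(G)}x^v_{d_A(v)},$$ where $d_A(v)$ is the degree of $v$ in the subgraph $(V(G),A)$. An Eulerian orientation of a graph with all degrees even is an orientation of its edges such that at each vertex the in-degree equals the out-degree. Connectedness is not assumed. *)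

theory Defs
  imports Complex_Main "Graph_Theory.Bidirected_Digraph"
begin

text \<open>
  A finite undirected graph is given by a finite digraph \<open>G\<close> together with an arc reversal
  \<open>arev\<close>, as in the locale \<^locale>\<open>bidirected_digraph\<close>: every undirected edge is
  represented by its two opposite arcs \<open>a\<close> and \<open>arev a \<noteq> a\<close>. A simple graph has the two
  arcs \<open>(u, v)\<close> and \<open>(v, u)\<close> for each edge \<open>{u, v}\<close>, with \<open>arev\<close> exchanging them.
  Parallel edges and loops are allowed as well. A loop is a pair of opposite arcs at the same
  vertex, so it contributes 2 to the degree and has two orientations.
\<close>

definition edges :: "('a, 'b) pre_digraph \<Rightarrow> ('b \<Rightarrow> 'b) \<Rightarrow> 'b set set" where
  "edges G arev = (\<lambda>a. {a, arev a}) ` arcs G"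

text \<open>
  Each end of an edge at \<open>v\<close> is the tail of exactly one of its two arcs, so the undirected
  degree is the out-degree.
\<close>

definition degree :: "('a, 'b) pre_digraph \<Rightarrow> 'a \<Rightarrow> nat" where
  "degree G v = out_degree G v"

definition spanning_subgraph :: "('a, 'b) pre_digraph \<Rightarrow> 'b set set \<Rightarrow> ('a, 'b) pre_digraph" where
  "spanning_subgraph G A = G\<lparr>arcs := \<Union>A\<rparr>"

text \<open>
  The variable \<open>x\<^sup>v\<^sub>k\<close> is \<open>x v k\<close>. Only the values with \<open>v \<in> verts G\<close> and
  \<open>k \<le> degree G v\<close> are used.
\<close>

definition subgraph_counting_poly ::
    "('a, 'b) pre_digraph \<Rightarrow> ('b \<Rightarrow> 'b) \<Rightarrow> ('a \<Rightarrow> nat \<Rightarrow> 'c::comm_semiring_1) \<Rightarrow> 'c" where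
  "subgraph_counting_poly G arev x =
     (\<Sum>A \<in> Pow (edges G arev). \<Prod>v\<in>verts G. x v (degree (spanning_subgraph G A) v))"

text \<open>An orientation is given by the set of arcs it selects, one out of each edge.\<close>

definition orientation :: "('a, 'b) pre_digraph \<Rightarrow> ('b \<Rightarrow> 'b) \<Rightarrow> 'b set \<Rightarrow> bool" where
  "orientation G arev S \<longleftrightarrow> S \<subseteq> arcs G \<and> (\<forall>e\<in>edges G arev. \<exists>!a. a \<in> e \<and> a \<in> S)"

definition eulerian_orientation :: "('a, 'b) pre_digraph \<Rightarrow> ('b \<Rightarrow> 'b) \<Rightarrow> 'b set \<Rightarrow> bool" where
  "eulerian_orientation G arev S \<longleftrightarrow> orientation G arev S \<and>
     (\<forall>v\<in>verts G. in_degree (G\<lparr>arcs := S\<rparr>) v = out_degree (G\<lparr>arcs := S\<rparr>) v)"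

definition s_vec :: "nat \<Rightarrow> nat \<Rightarrow> real" where
  "s_vec d k =
     (if even k
      then real (d choose (d div 2)) * real ((d div 2) choose (k div 2))
             / (2 ^ (d div 2) * real (d choose k))
      else 0)"

end

theory Submission
  imports "HOL-Computational_Algebra.Polynomial" "HOL-Library.FuncSet" Defs
begin

text \<open>
  A set \<open>T\<close> of arcs is an orientation iff \<open>(1 - (-1) ^ card (T \<inter> e)) / 2\<close> equals 1 for every
  edge \<open>e\<close>, and an orientation is Eulerian iff it contains half of the arcs leaving each vertex.
  Expanding the product of these edge factors over sets \<open>A\<close> of edges turns the number of
  Eulerian orientations into a signed sum over \<open>A\<close> and over all sets \<open>T\<close> of arcs that are balanced
  at each vertex. For fixed \<open>A\<close> the sum over \<open>T\<close> factors over the vertices, and the factor at a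
  vertex of degree \<open>d\<close> is the value at \<open>d\<^sub>A(v)\<close> of the Krawtchouk polynomial of degree \<open>d / 2\<close>.
  By reciprocity it is a coefficient of \<open>(1 - x) ^ (d/2) * (1 + x) ^ (d/2) = (1 - x\<^sup>2) ^ (d/2)\<close>,
  which gives \<open>s_vec\<close> up to a sign and a power of 2. By the handshake lemma these signs and powers
  cancel against \<open>(-1) ^ card A\<close> and the denominators 2 of the edge factors.
\<close>

section \<open>Krawtchouk polynomials\<close>

text \<open>For \<open>k \<le> d\<close> this is the value at \<open>k\<close> of the binary
  Krawtchouk polynomial of degree \<open>m\<close> and length \<open>d\<close>, encoded by its
  generating function in \<open>m\<close>.\<close>

definition krawtchouk :: "nat \<Rightarrow> nat \<Rightarrow> nat \<Rightarrow> real" where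
  "krawtchouk d k m = coeff ([:1, -1:] ^ k * [:1, 1:] ^ (d - k)) m"

text \<open>Expand the product of \<open>1 + c a * x\<close> over \<open>D\<close>, with
  \<open>c a = -1\<close> on \<open>B\<close> and \<open>1\<close> elsewhere: choosing the linear
  terms at \<open>T\<close> contributes the sign of \<open>T \<inter> B\<close> in degree
  \<open>card T\<close>.\<close>

lemma krawtchouk_eq_sum_subsets:
  assumes "finite D" "B \<subseteq> D"
  shows "(\<Sum>T | T \<subseteq> D \<and> card T = m. (-1) ^ card (T \<inter> B)) = krawtchouk (card D) (card B) m"
proof -
  define c :: "'a \<Rightarrow> real" where "c = (\<lambda>a. if a \<in> B then -1 else 1)"
  have monom_prod: "(\<Prod>a\<in>T. monom (c a) 1) = monom ((-1) ^ card (T \<inter> B)) (card T)"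
    if "finite T" for T
    using that by (induction T rule: finite_induct) (auto simp: c_def mult_monom Int_insert_left)
  have "(\<Prod>a\<in>D. monom (c a) 1 + 1) = (\<Prod>a\<in>B. monom (c a) 1 + 1) * (\<Prod>a\<in>D - B. monom (c a) 1 + 1)"
    using prod.subset_diff [OF assms(2,1)] by (simp add: mult.commute)
  also have "(\<Prod>a\<in>B. monom (c a) 1 + 1) = (\<Prod>a\<in>B. [:1, -1:])"
    by (rule prod.cong) (auto simp: c_def monom_altdef one_pCons)
  also have "(\<Prod>a\<in>D - B. monom (c a) 1 + 1) = (\<Prod>a\<in>D - B. [:1, 1:])"
    by (rule prod.cong) (auto simp: c_def monom_altdef one_pCons)
  finally have "krawtchouk (card D) (card B) m = coeff (\<Prod>a\<in>D. monom (c a) 1 + 1) m"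
    using assms by (simp add: krawtchouk_def card_Diff_subset finite_subset)
  also have "(\<Prod>a\<in>D. monom (c a) 1 + 1) = (\<Sum>T\<in>Pow D. \<Prod>a\<in>T. monom (c a) 1)"
    by (subst prod_add) (use assms in auto)
  also have "\<dots> = (\<Sum>T\<in>Pow D. monom ((-1) ^ card (T \<inter> B)) (card T))"
    using assms by (intro sum.cong refl monom_prod) (auto intro: finite_subset)
  also have "coeff \<dots> m = (\<Sum>T\<in>Pow D. if card T = m then (-1) ^ card (T \<inter> B) else 0)"
    by (simp add: coeff_sum)
  also have "\<dots> = (\<Sum>T | T \<subseteq> D \<and> card T = m. (-1) ^ card (T \<inter> B))"
    using assms by (subst sum.inter_filter [symmetric]) (auto intro: sum.cong)
  finally show ?thesis ..
qed

text \<open>Both sides count pairs of a \<open>k\<close>-set and an \<open>m\<close>-set, signed by the parity of the intersection.\<close>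

lemma krawtchouk_reciprocity:
  "real (d choose k) * krawtchouk d k m = real (d choose m) * krawtchouk d m k"
proof -
  define P where "P = (\<lambda>j. {T. T \<subseteq> {..<d} \<and> card T = j})"
  have card_P: "card (P j) = d choose j" for j
    by (simp add: P_def n_subsets)
  have inner: "(\<Sum>T\<in>P j. (-1) ^ card (T \<inter> B)) = krawtchouk d i j" if "B \<in> P i" for B i j
    using krawtchouk_eq_sum_subsets [of "{..<d}" B j] that by (auto simp: P_def)
  have "real (d choose k) * krawtchouk d k m = (\<Sum>B\<in>P k. \<Sum>T\<in>P m. (-1) ^ card (T \<inter> B))"
    by (simp add: inner card_P)
  also have "\<dots> = (\<Sum>T\<in>P m. \<Sum>B\<in>P k. (-1) ^ card (B \<inter> T))"
    by (subst sum.swap) (simp add: Int_commute)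
  also have "\<dots> = real (d choose m) * krawtchouk d m k"
    by (simp add: inner card_P)
  finally show ?thesis .
qed

text \<open>Equal exponents merge the generating function into \<open>(1 - x^2)^m\<close>, which has
  no odd coefficients.\<close>

lemma krawtchouk_half:
  "krawtchouk (2 * m) m k = (if even k then (-1) ^ (k div 2) * real (m choose (k div 2)) else 0)"
proof -
  have "[:1, -1:] ^ m * [:1, 1:] ^ m = (monom (-1) 2 + 1 :: real poly) ^ m"
    by (simp add: power_mult_distrib [symmetric] monom_altdef one_pCons numeral_2_eq_2)
  also have "\<dots> = (\<Sum>j\<le>m. monom (real (m choose j) * (-1) ^ j) (2 * j))"
    by (simp add: binomial_ring monom_power of_nat_monom mult_monom)
  finally have "krawtchouk (2 * m) m k
      = (\<Sum>j\<le>m. if 2 * j = k then real (m choose j) * (-1) ^ j else 0)"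
    by (simp add: krawtchouk_def coeff_sum)
  also have "\<dots> = (if even k then (-1) ^ (k div 2) * real (m choose (k div 2)) else 0)"
  proof (cases "even k")
    case True
    then obtain i where "k = 2 * i" by blast
    then show ?thesis by (simp add: sum.delta)
  next
    case False
    then have "2 * j \<noteq> k" for j by auto
    with False show ?thesis by simp
  qed
  finally show ?thesis .
qed

text \<open>Reciprocity swaps \<open>k\<close> with the middle index \<open>m\<close>, which leads
  back to \<open>krawtchouk_half\<close>.\<close>

lemma krawtchouk_middle:
  assumes "k \<le> 2 * m"
  shows "krawtchouk (2 * m) k m
    = (if even k then (-1) ^ (k div 2) * 2 ^ m * s_vec (2 * m) k else 0)"
proof -
  \<comment> \<open>The bound on \<open>k\<close> is what allows reciprocity to be divided by this
    binomial.\<close>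
  have "real (2 * m choose k) > 0"
    using assms by simp
  then have "krawtchouk (2 * m) k m
      = real (2 * m choose m) * krawtchouk (2 * m) m k / real (2 * m choose k)"
    using krawtchouk_reciprocity [of "2 * m" k m] by (simp add: field_simps)
  then show ?thesis
    by (simp add: krawtchouk_half s_vec_def)
qed

section \<open>Factoring sums over subsets along fibres\<close>

text \<open>By distributivity: a subset of \<open>E\<close> amounts to an independent choice of a
  subset of each fibre of \<open>t\<close>. With \<open>t\<close> the tail map, sums over sets of
  arcs factor over the vertices.\<close>

lemma prod_sum_Pow_fibres:
  fixes h :: "'v \<Rightarrow> 'e set \<Rightarrow> 'c :: comm_semiring_1"
  assumes "finite V" "finite E" "t ` E \<subseteq> V"
  shows "(\<Prod>v\<in>V. \<Sum>T\<in>Pow {a \<in> E. t a = v}. h v T)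
    = (\<Sum>T\<in>Pow E. \<Prod>v\<in>V. h v {a \<in> T. t a = v})"
proof -
  have "(\<Prod>v\<in>V. \<Sum>T\<in>Pow {a \<in> E. t a = v}. h v T)
      = (\<Sum>g\<in>(\<Pi>\<^sub>E v\<in>V. Pow {a \<in> E. t a = v}). \<Prod>v\<in>V. h v (g v))"
    using assms by (intro prod_sum_PiE) auto
  also have "\<dots> = (\<Sum>T\<in>Pow E. \<Prod>v\<in>V. h v {a \<in> T. t a = v})"
  proof (rule sum.reindex_bij_witness
      [where i = "\<lambda>T. \<lambda>v\<in>V. {a \<in> T. t a = v}" and j = "\<lambda>g. \<Union>v\<in>V. g v"])
    fix g assume "g \<in> (\<Pi>\<^sub>E v\<in>V. Pow {a \<in> E. t a = v})"
    then have g: "g \<in> extensional V" "\<And>v. v \<in> V \<Longrightarrow> g v \<subseteq> {a \<in> E. t a = v}"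
      by (auto simp: PiE_def Pi_def)
    have fibre: "{a \<in> (\<Union>w\<in>V. g w). t a = v} = g v" if "v \<in> V" for v
      using g(2) that by blast
    then show "(\<lambda>v\<in>V. {a \<in> (\<Union>w\<in>V. g w). t a = v}) = g"
      \<comment> \<open>Extensionality makes both functions agree outside \<open>V\<close> as
        well.\<close>
      using g(1) by (auto simp: extensional_def fun_eq_iff restrict_def)
    show "(\<Union>v\<in>V. g v) \<in> Pow E"
      using g(2) by blast
    show "(\<Prod>v\<in>V. h v {a \<in> (\<Union>w\<in>V. g w). t a = v}) = (\<Prod>v\<in>V. h v (g v))"
      using fibre by simp
  next
    fix T assume "T \<in> Pow E"
    then show "(\<Union>v\<in>V. (\<lambda>v\<in>V. {a \<in> T. t a = v}) v) = T"
      using assms(3) by auto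
    show "(\<lambda>v\<in>V. {a \<in> T. t a = v}) \<in> (\<Pi>\<^sub>E v\<in>V. Pow {a \<in> E. t a = v})"
      using \<open>T \<in> Pow E\<close> by auto
  qed
  finally show ?thesis .
qed

section \<open>Edges as pairs of opposite arcs\<close>

locale fin_bidirected_digraph = fin_digraph G + bidirected_digraph G arev for G arev
begin

lemma finite_edges: "finite (edges G arev)"
  by (simp add: edges_def)

lemma Union_edges: "\<Union>(edges G arev) = arcs G"
  by (auto simp: edges_def)

lemma edgeE:
  assumes "e \<in> edges G arev"
  obtains a where "a \<in> arcs G" "arev a \<noteq> a" "e = {a, arev a}"
  using assms arev_neq by (auto simp: edges_def)

lemma edges_disjoint:
  assumes "e \<in> edges G arev" "f \<in> edges G arev" "e \<noteq> f"
  shows "e \<inter> f = {}"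
  using assms by (auto simp: edges_def arev_eq_iff)

text \<open>Distinct edges are disjoint sets of arcs, so the sizes add. A product of edge signs over
  \<open>A\<close> thereby becomes a single sign.\<close>

lemma card_Union_Int_edges:
  assumes "A \<subseteq> edges G arev"
  shows "card (T \<inter> \<Union>A) = (\<Sum>e\<in>A. card (T \<inter> e))"
proof -
  have "T \<inter> \<Union>A = (\<Union>e\<in>A. T \<inter> e)"
    by blast
  also have "card \<dots> = (\<Sum>e\<in>A. card (T \<inter> e))"
  proof (rule card_UN_disjoint)
    show "finite A"
      using assms finite_edges finite_subset by blast
    show "\<forall>e\<in>A. finite (T \<inter> e)"
      using assms by (auto elim!: edgeE)
    show "\<forall>e\<in>A. \<forall>f\<in>A. e \<noteq> f \<longrightarrow> T \<inter> e \<inter> (T \<inter> f) = {}"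
      using assms edges_disjoint by blast
  qed
  finally show ?thesis .
qed

lemma card_Union_edges:
  assumes "A \<subseteq> edges G arev"
  shows "card (\<Union>A) = 2 * card A"
proof -
  have "card (\<Union>A) = (\<Sum>e\<in>A. card e)"
    using card_Union_Int_edges [OF assms, of UNIV] by simp
  also have "\<dots> = (\<Sum>e\<in>A. 2)"
    using assms by (intro sum.cong) (auto elim!: edgeE)
  finally show ?thesis by simp
qed

text \<open>Every arc has exactly one tail. For \<open>S = \<Union>A\<close>, combined with
  \<open>card_Union_edges\<close>, this is the handshake lemma.\<close>

lemma card_eq_sum_fibres:
  assumes "S \<subseteq> arcs G"
  shows "card S = (\<Sum>v\<in>verts G. card {a \<in> S. tail G a = v})"
proof -
  have "S = (\<Union>v\<in>verts G. {a \<in> S. tail G a = v})"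
    using assms by auto
  also have "card \<dots> = (\<Sum>v\<in>verts G. card {a \<in> S. tail G a = v})"
    using assms finite_subset [OF _ finite_arcs] by (intro card_UN_disjoint) auto
  finally show ?thesis .
qed

lemma degree_spanning_subgraph:
  "degree (spanning_subgraph G A) v = card {a \<in> \<Union>A. tail G a = v}"
  by (simp add: degree_def out_degree_def out_arcs_def spanning_subgraph_def)

section \<open>Orientations and their sign expansion\<close>

lemma orientation_indicator:
  assumes "T \<subseteq> arcs G"
  shows "(\<Prod>e\<in>edges G arev. (1 - (-1) ^ card (T \<inter> e)) / 2) = (of_bool (orientation G arev T) :: real)"
proof -
  have "(1 - (-1) ^ card (T \<inter> e)) / 2 = (of_bool (\<exists>!a. a \<in> e \<and> a \<in> T) :: real)"
    if e: "e \<in> edges G arev" for e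
  proof -
    obtain a where "arev a \<noteq> a" "e = {a, arev a}"
      using e by (rule edgeE)
    then show ?thesis
      \<comment> \<open>The intersection has 0, 1 or 2 elements, and the factor is 1 only for
        1.\<close>
      by (cases "a \<in> T"; cases "arev a \<in> T") (auto simp: Int_insert_right)
  qed
  then have "(\<Prod>e\<in>edges G arev. (1 - (-1) ^ card (T \<inter> e)) / 2)
      = (\<Prod>e\<in>edges G arev. (of_bool (\<exists>!a. a \<in> e \<and> a \<in> T) :: real))"
    by (rule prod.cong [OF refl])
  also have "\<dots> = of_bool (orientation G arev T)"
  proof (cases "orientation G arev T")
    case True
    then show ?thesis by (auto simp: orientation_def)
  next
    case False
    then obtain e where "e \<in> edges G arev" "\<not> (\<exists>!a. a \<in> e \<and> a \<in> T)"
      using assms unfolding orientation_def by blast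
    then show ?thesis
      using False finite_edges by (auto intro!: prod_zero bexI [of _ e])
  qed
  finally show ?thesis .
qed

text \<open>In the product of \<open>1 - (-1) ^ card (T \<inter> e)\<close>, let \<open>A\<close> be
  the set of edges at which the second term is chosen. These sets become the subgraphs summed over
  in the counting polynomial.\<close>

lemma orientation_indicator_expansion:
  assumes "T \<subseteq> arcs G"
  shows "(of_bool (orientation G arev T) :: real)
    = (\<Sum>A\<in>Pow (edges G arev). (-1) ^ card A * (-1) ^ card (T \<inter> \<Union>A)) / 2 ^ card (edges G arev)"
proof -
  have "of_bool (orientation G arev T)
      = (\<Prod>e\<in>edges G arev. 1 - (-1) ^ card (T \<inter> e)) / (2 ^ card (edges G arev) :: real)"
    using orientation_indicator [OF assms] by (simp add: prod_dividef)
  also have "(\<Prod>e\<in>edges G arev. 1 - (-1) ^ card (T \<inter> e))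
      = (\<Sum>A\<in>Pow (edges G arev). (-1) ^ card A * (\<Prod>e\<in>A. (-1 :: real) ^ card (T \<inter> e)))"
    by (simp add: prod_diff_conv_sum finite_edges)
  also have "\<dots> = (\<Sum>A\<in>Pow (edges G arev). (-1) ^ card A * (-1) ^ card (T \<inter> \<Union>A))"
    by (intro sum.cong) (auto simp: card_Union_Int_edges power_sum)
  finally show ?thesis .
qed

text \<open>The selected arcs entering \<open>v\<close> are the reversals of the arcs leaving
  \<open>v\<close> that \<open>S\<close> omits.\<close>

lemma in_degree_orientation:
  assumes "orientation G arev S"
  shows "in_degree (G\<lparr>arcs := S\<rparr>) v = degree G v - card {a \<in> S. tail G a = v}"
proof -
  have S: "S \<subseteq> arcs G"
    using assms by (simp add: orientation_def)
  have one: "arev a \<in> S \<longleftrightarrow> a \<notin> S" if "a \<in> arcs G" for a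
  proof -
    have "{a, arev a} \<in> edges G arev"
      using that by (simp add: edges_def)
    with assms have "\<exists>!b. b \<in> {a, arev a} \<and> b \<in> S"
      unfolding orientation_def by (elim conjE bspec)
    then show ?thesis
      using arev_neq [OF that] by auto
  qed
  have "{a \<in> S. head G a = v} = arev ` ({a \<in> arcs G. tail G a = v} - {a \<in> S. tail G a = v})"
    (is "?L = arev ` ?R")
  proof (intro set_eqI iffI)
    fix a assume "a \<in> ?L"
    then have "arev a \<in> ?R"
      using S one by auto
    then show "a \<in> arev ` ?R"
      by (rule image_eqI [rotated]) simp
  next
    fix a assume "a \<in> arev ` ?R"
    then show "a \<in> ?L"
      using one by auto
  qed
  then have "card {a \<in> S. head G a = v} = card ?R"
    by (simp add: card_image inj_on_arev)
  also have "\<dots> = degree G v - card {a \<in> S. tail G a = v}"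
    using S finite_subset [OF S]
    by (subst card_Diff_subset) (auto simp: degree_def out_degree_def out_arcs_def)
  finally show ?thesis
    by (simp add: in_degree_def in_arcs_def)
qed

lemma card_out_le_degree:
  assumes "S \<subseteq> arcs G"
  shows "card {a \<in> S. tail G a = v} \<le> degree G v"
  using assms by (auto simp: degree_def out_degree_def out_arcs_def intro!: card_mono)

text \<open>If \<open>p\<close> of the \<open>d\<close> arcs leaving \<open>v\<close> are selected,
  the in-degree is \<open>d - p\<close>, which equals \<open>p\<close> iff \<open>p = d / 2\<close>.
  Here \<open>p \<le> d\<close> keeps the subtraction exact, and evenness the halving.\<close>

lemma eulerian_orientation_iff:
  assumes "\<And>v. v \<in> verts G \<Longrightarrow> even (degree G v)"
  shows "eulerian_orientation G arev S \<longleftrightarrow>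
    orientation G arev S \<and> (\<forall>v\<in>verts G. card {a \<in> S. tail G a = v} = degree G v div 2)"
proof (cases "orientation G arev S")
  case True
  then have "S \<subseteq> arcs G"
    by (simp add: orientation_def)
  then have "in_degree (G\<lparr>arcs := S\<rparr>) v = out_degree (G\<lparr>arcs := S\<rparr>) v \<longleftrightarrow>
      card {a \<in> S. tail G a = v} = degree G v div 2" if "v \<in> verts G" for v
    using assms [OF that] card_out_le_degree [of S v] in_degree_orientation [OF True, of v]
    by (auto simp: out_degree_def out_arcs_def elim!: evenE)
  with True show ?thesis
    by (simp add: eulerian_orientation_def)
qed (simp add: eulerian_orientation_def)

section \<open>Vertex factors and their normalization\<close>

text \<open>Splitting \<open>T\<close> by tails splits both the sign and the balance condition,
  leaving at each vertex a signed sum over half-size sets of outgoing arcs.\<close>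

lemma sum_balanced_signs:
  assumes A: "A \<subseteq> edges G arev"
  shows "(\<Sum>T\<in>Pow (arcs G). (-1) ^ card (T \<inter> \<Union>A) *
      (\<Prod>v\<in>verts G. of_bool (card {a \<in> T. tail G a = v} = degree G v div 2)))
    = (\<Prod>v\<in>verts G. krawtchouk (degree G v) (degree (spanning_subgraph G A) v) (degree G v div 2))"
proof -
  have UA: "\<Union>A \<subseteq> arcs G"
    using A Union_edges by blast
  define out where "out = (\<lambda>S v. {a \<in> S. tail G a = v})"
  define h :: "'a \<Rightarrow> 'b set \<Rightarrow> real" where
    "h = (\<lambda>v T. (-1) ^ card (T \<inter> out (\<Union>A) v) * of_bool (card T = degree G v div 2))"
  have "(-1) ^ card (T \<inter> \<Union>A) * (\<Prod>v\<in>verts G. of_bool (card (out T v) = degree G v div 2))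
      = (\<Prod>v\<in>verts G. h v (out T v))" if "T \<in> Pow (arcs G)" for T
  proof -
    have "out (T \<inter> \<Union>A) v = out T v \<inter> out (\<Union>A) v" for v
      by (auto simp: out_def)
    then have "card (T \<inter> \<Union>A) = (\<Sum>v\<in>verts G. card (out T v \<inter> out (\<Union>A) v))"
      using that card_eq_sum_fibres [of "T \<inter> \<Union>A"] by (auto simp: out_def)
    then show ?thesis
      by (simp add: h_def prod.distrib power_sum)
  qed
  then have "(\<Sum>T\<in>Pow (arcs G). (-1) ^ card (T \<inter> \<Union>A) *
      (\<Prod>v\<in>verts G. of_bool (card (out T v) = degree G v div 2)))
    = (\<Sum>T\<in>Pow (arcs G). \<Prod>v\<in>verts G. h v (out T v))"
    by (rule sum.cong [OF refl])
  also have "\<dots> = (\<Prod>v\<in>verts G. \<Sum>T\<in>Pow (out (arcs G) v). h v T)"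
    unfolding out_def by (rule prod_sum_Pow_fibres [symmetric]) auto
  also have "\<dots> = (\<Prod>v\<in>verts G. krawtchouk (degree G v) (degree (spanning_subgraph G A) v) (degree G v div 2))"
  proof (rule prod.cong [OF refl])
    fix v
    have fin: "finite (out (arcs G) v)"
      by (simp add: out_def)
    have "(\<Sum>T\<in>Pow (out (arcs G) v). h v T)
        = (\<Sum>T | T \<subseteq> out (arcs G) v \<and> card T = degree G v div 2. (-1) ^ card (T \<inter> out (\<Union>A) v))"
      \<comment> \<open>Sets of the wrong size contribute 0.\<close>
      unfolding h_def by (rule sum.mono_neutral_cong_right) (use fin in auto)
    also have "\<dots> = krawtchouk (card (out (arcs G) v)) (card (out (\<Union>A) v)) (degree G v div 2)"
      by (rule krawtchouk_eq_sum_subsets [OF fin]) (use UA in \<open>auto simp: out_def\<close>)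
    also have "card (out (arcs G) v) = degree G v"
      by (simp add: out_def degree_def out_degree_def out_arcs_def)
    also have "card (out (\<Union>A) v) = degree (spanning_subgraph G A) v"
      by (simp add: out_def degree_spanning_subgraph)
    finally show "(\<Sum>T\<in>Pow (out (arcs G) v). h v T)
        = krawtchouk (degree G v) (degree (spanning_subgraph G A) v) (degree G v div 2)" .
  qed
  finally show ?thesis
    by (simp add: out_def)
qed

lemma prod_krawtchouk_eq_prod_s_vec:
  assumes even: "\<And>v. v \<in> verts G \<Longrightarrow> even (degree G v)"
    and A: "A \<subseteq> edges G arev"
  defines "k \<equiv> degree (spanning_subgraph G A)"
  shows "(-1) ^ card A * (\<Prod>v\<in>verts G. krawtchouk (degree G v) (k v) (degree G v div 2))
    = 2 ^ card (edges G arev) * (\<Prod>v\<in>verts G. s_vec (degree G v) (k v))"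
proof -
  have UA: "\<Union>A \<subseteq> arcs G"
    using A Union_edges by blast
  have kraw: "krawtchouk (degree G v) (k v) (degree G v div 2)
      = (if even (k v) then (-1) ^ (k v div 2) * 2 ^ (degree G v div 2) * s_vec (degree G v) (k v) else 0)"
    if "v \<in> verts G" for v
    using krawtchouk_middle [of "k v" "degree G v div 2"] even [OF that] card_out_le_degree [OF UA, of v]
    by (simp add: k_def degree_spanning_subgraph)
  show ?thesis
  proof (cases "\<forall>v\<in>verts G. even (k v)")
    case True
    \<comment> \<open>The handshake lemma for \<open>A\<close>, in halved form: the halves lose
      nothing because every \<open>k v\<close> is even.\<close>
    have "2 * (\<Sum>v\<in>verts G. k v div 2) = (\<Sum>v\<in>verts G. k v)"
      using True by (simp add: sum_distrib_left)
    also have "\<dots> = 2 * card A"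
      using card_eq_sum_fibres [OF UA] card_Union_edges [OF A] by (simp add: k_def degree_spanning_subgraph)
    finally have cA: "(\<Sum>v\<in>verts G. k v div 2) = card A"
      by simp
    have "2 * (\<Sum>v\<in>verts G. degree G v div 2) = (\<Sum>v\<in>verts G. degree G v)"
      using even by (simp add: sum_distrib_left)
    also have "\<dots> = 2 * card (edges G arev)"
      using card_eq_sum_fibres [of "arcs G"] card_Union_edges [of "edges G arev"]
      by (simp add: Union_edges degree_def out_degree_def out_arcs_def)
    finally have cE: "(\<Sum>v\<in>verts G. degree G v div 2) = card (edges G arev)"
      by simp
    have "(\<Prod>v\<in>verts G. krawtchouk (degree G v) (k v) (degree G v div 2))
        = (\<Prod>v\<in>verts G. (-1) ^ (k v div 2) * 2 ^ (degree G v div 2) * s_vec (degree G v) (k v))"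
      using True kraw by (intro prod.cong) auto
    also have "\<dots> = (-1) ^ card A * 2 ^ card (edges G arev) * (\<Prod>v\<in>verts G. s_vec (degree G v) (k v))"
      by (simp add: prod.distrib cA cE flip: power_sum)
    finally show ?thesis
      \<comment> \<open>The sign \<open>(-1) ^ card A\<close> now occurs twice and cancels.\<close>
      by (simp flip: power_add mult_2 mult.assoc)
  next
    case False
    \<comment> \<open>A single vertex of odd degree in \<open>A\<close> makes both products
      vanish.\<close>
    then obtain v where v: "v \<in> verts G" "odd (k v)" by blast
    then have "krawtchouk (degree G v) (k v) (degree G v div 2) = 0" "s_vec (degree G v) (k v) = 0"
      using kraw by (auto simp: s_vec_def)
    with v have "(\<Prod>v\<in>verts G. krawtchouk (degree G v) (k v) (degree G v div 2)) = 0"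
      "(\<Prod>v\<in>verts G. s_vec (degree G v) (k v)) = 0"
      using finite_verts by (auto intro!: prod_zero)
    then show ?thesis by (simp only: mult_zero_right)
  qed
qed

section \<open>Double counting of Eulerian orientations\<close>

theorem card_eulerian_orientations:
  assumes even: "\<And>v. v \<in> verts G \<Longrightarrow> even (degree G v)"
  shows "real (card {S. eulerian_orientation G arev S})
    = subgraph_counting_poly G arev (\<lambda>v k. s_vec (degree G v) k)"
proof -
  define bal :: "'b set \<Rightarrow> real" where
    "bal = (\<lambda>T. \<Prod>v\<in>verts G. of_bool (card {a \<in> T. tail G a = v} = degree G v div 2))"
  \<comment> \<open>The product form of \<open>bal\<close> serves the factorization over vertices,
    the indicator form the Eulerian condition.\<close>
  have bal: "bal T = of_bool (\<forall>v\<in>verts G. card {a \<in> T. tail G a = v} = degree G v div 2)" for T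
    using finite_verts unfolding bal_def by (cases "\<forall>v\<in>verts G. card {a \<in> T. tail G a = v} = degree G v div 2") auto
  define E where "E = edges G arev"
  have "{S. eulerian_orientation G arev S} = {S \<in> Pow (arcs G). eulerian_orientation G arev S}"
    by (auto simp: eulerian_orientation_def orientation_def)
  then have "real (card {S. eulerian_orientation G arev S})
      = (\<Sum>T\<in>Pow (arcs G). of_bool (eulerian_orientation G arev T))"
    by (simp add: Int_def)
  also have "\<dots> = (\<Sum>T\<in>Pow (arcs G). of_bool (orientation G arev T) * bal T)"
    by (intro sum.cong) (auto simp: bal eulerian_orientation_iff [OF even])
  also have "\<dots> = (\<Sum>T\<in>Pow (arcs G). \<Sum>A\<in>Pow E.
      (-1) ^ card A / 2 ^ card E * ((-1) ^ card (T \<inter> \<Union>A) * bal T))"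
    by (intro sum.cong)
      (auto simp: orientation_indicator_expansion E_def sum_divide_distrib sum_distrib_right mult.assoc)
  also have "\<dots> = (\<Sum>A\<in>Pow E. (-1) ^ card A / 2 ^ card E *
      (\<Sum>T\<in>Pow (arcs G). (-1) ^ card (T \<inter> \<Union>A) * bal T))"
    \<comment> \<open>With \<open>A\<close> outermost, the inner sum over \<open>T\<close> is the
      one evaluated by \<open>sum_balanced_signs\<close>.\<close>
    by (subst sum.swap) (simp only: sum_distrib_left)
  also have "\<dots> = (\<Sum>A\<in>Pow E. \<Prod>v\<in>verts G. s_vec (degree G v) (degree (spanning_subgraph G A) v))"
  proof (rule sum.cong [OF refl])
    fix A assume "A \<in> Pow E"
    then have A: "A \<subseteq> edges G arev"
      by (simp add: E_def)
    show "(-1) ^ card A / 2 ^ card E * (\<Sum>T\<in>Pow (arcs G). (-1) ^ card (T \<inter> \<Union>A) * bal T)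
        = (\<Prod>v\<in>verts G. s_vec (degree G v) (degree (spanning_subgraph G A) v))"
      using sum_balanced_signs [OF A] prod_krawtchouk_eq_prod_s_vec [OF even A]
      by (simp add: bal_def E_def)
  qed
  finally show ?thesis
    by (simp add: subgraph_counting_poly_def E_def)
qed

end

theorem theorem5p3:
  fixes G :: "('a, 'b) pre_digraph" and arev :: "'b \<Rightarrow> 'b"
  assumes "fin_digraph G"
    and "bidirected_digraph G arev"
    and "\<And>v. v \<in> verts G \<Longrightarrow> even (degree G v)"
  shows "subgraph_counting_poly G arev (\<lambda>v k. s_vec (degree G v) k)
           = real (card {S. eulerian_orientation G arev S})"
proof -
  interpret fin_bidirected_digraph G arev
    using assms(1,2) by (simp add: fin_bidirected_digraph_def)
  show ?thesis
    using card_eulerian_orientations [OF assms(3)] by simp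
qed

end
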